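(* There is an uncountable set $L \subset \mathbb R$, dense in $\mathbb R$, such that the series \[ \sum_{n=1}^{\infty} \frac{(-1)^n |\sin(n\pi\alpha)|}{n^p} \] diverges for all $\alpha \in L$ and all $p \in (0,1]$. *)

theory Defs
  imports "HOL-Analysis.Analysis"
begin

end

theory Submission
  imports Defs
begin

text \<open>
  Write \<open>e n = (-1) ^ n * \<bar>sin (n * pi * \<alpha>)\<bar>\<close>. For a rational \<open>\<alpha> = a / b\<close> in lowest terms with \<open>b\<close> even,
  the sequence \<open>e\<close> has period \<open>b\<close>, and the sign \<open>(-1) ^ n\<close> resonates with the sine: multiplication
  by the odd number \<open>a\<close> permutes the residues modulo \<open>b\<close> and preserves their parity, so the sum of
  \<open>e\<close> over a period is the same as for \<open>a = 1\<close>, where it telescopes to \<open>- tan (pi / (2 * b))\<close>. As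
  the mean is not zero, the partial sums of \<open>e n / n\<close> grow like a multiple of the harmonic sums.

  Such rationals are dense, and for fixed \<open>M\<close> the set of all \<open>\<alpha>\<close> for which some partial sum of
  \<open>e n / n\<close> exceeds \<open>M\<close> in absolute value is open because the partial sums are continuous in \<open>\<alpha>\<close>.
  By the Baire category theorem, the set \<open>L\<close> of those \<open>\<alpha>\<close> whose partial sums are unbounded is dense;
  it is also uncountable, as otherwise the complements of its points could be added to the
  countable family of dense open sets, whose intersection would become empty.

  Finally, one exponent is enough: multiplying by the decreasing factors \<open>n powr (p - 1)\<close> turns
  bounded partial sums for the exponent \<open>p \<le> 1\<close> into bounded partial sums for the exponent 1
  (Abel's inequality), so no series with \<open>\<alpha> \<in> L\<close> and \<open>p \<le> 1\<close> converges.
\<close>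

section \<open>Abel's inequality\<close>

lemma summation_by_parts:
  fixes a g :: "nat \<Rightarrow> real"
  shows "(\<Sum>k<n. a k * g k) = (\<Sum>k<n. a k) * g n + (\<Sum>k<n. (\<Sum>i<Suc k. a i) * (g k - g (Suc k)))"
  by (induction n) (simp_all add: algebra_simps)

lemma Abel_inequality:
  fixes a g :: "nat \<Rightarrow> real"
  assumes bound: "\<And>n. \<bar>\<Sum>k<n. a k\<bar> \<le> B"
    and "decseq g" and nonneg: "\<And>n. 0 \<le> g n"
  shows "\<bar>\<Sum>k<n. a k * g k\<bar> \<le> B * g 0"
proof -
  have diff: "0 \<le> g k - g (Suc k)" for k
    using \<open>decseq g\<close> by (simp add: decseq_Suc_iff)
  have "\<bar>\<Sum>k<n. a k * g k\<bar> \<le> \<bar>(\<Sum>k<n. a k) * g n\<bar> + (\<Sum>k<n. \<bar>(\<Sum>i<Suc k. a i) * (g k - g (Suc k))\<bar>)"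
    unfolding summation_by_parts[of a g n]
    by (rule order_trans[OF abs_triangle_ineq add_left_mono[OF sum_abs]])
  also have "\<dots> \<le> B * g n + (\<Sum>k<n. B * (g k - g (Suc k)))"
    unfolding abs_mult abs_of_nonneg[OF nonneg] abs_of_nonneg[OF diff]
    by (intro add_mono sum_mono mult_right_mono bound nonneg diff)
  also have "\<dots> = B * g 0"
    unfolding sum_distrib_left[symmetric] sum_lessThan_telescope' by (simp add: algebra_simps)
  finally show ?thesis .
qed

section \<open>Periodic sequences with nonzero mean\<close>

lemma sum_lessThan_mod_period:
  fixes f :: "nat \<Rightarrow> real"
  assumes period: "\<And>n. f (n + b) = f n" and "(\<Sum>k<b. f k) = 0"
  shows "(\<Sum>k<n. f k) = (\<Sum>k<n mod b. f k)"
proof -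
  have split: "(\<Sum>k<m + b. f k) = (\<Sum>k<m. f k)" for m
    by (induction m) (simp_all add: assms)
  have "(\<Sum>k<r + q * b. f k) = (\<Sum>k<r. f k)" for q r
  proof (induction q)
    case (Suc q)
    then show ?case
      using split[of "r + q * b"] by (simp add: add_ac)
  qed simp
  from this[of "n mod b" "n div b"] show ?thesis
    by simp
qed

text \<open>
  Subtracting the mean \<open>m\<close> leaves a sequence with bounded partial sums, to which Abel's inequality
  applies; what remains is \<open>m\<close> times the harmonic series.
\<close>

lemma unbounded_harmonic_weighted_sums:
  fixes f :: "nat \<Rightarrow> real"
  assumes "b > 0" and period: "\<And>n. f (n + b) = f n" and nonzero: "(\<Sum>k<b. f k) \<noteq> 0"
  shows "\<exists>n. M < \<bar>\<Sum>k<n. f k / real (Suc k)\<bar>"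
proof (rule ccontr)
  assume "\<not> ?thesis"
  then have M: "\<bar>\<Sum>k<n. f k / real (Suc k)\<bar> \<le> M" for n
    by (auto simp: not_less)
  define m where "m = (\<Sum>k<b. f k) / real b"
  have "m \<noteq> 0"
    using assms by (simp add: m_def)
  define g where "g k = f k - m" for k
  have "g (n + b) = g n" for n
    by (simp add: g_def period)
  moreover have "(\<Sum>k<b. g k) = 0"
    using \<open>b > 0\<close> by (simp add: g_def sum_subtractf m_def)
  ultimately have mod: "(\<Sum>k<n. g k) = (\<Sum>k<n mod b. g k)" for n
    by (rule sum_lessThan_mod_period)
  define B where "B = (\<Sum>r<b. \<bar>\<Sum>k<r. g k\<bar>)"
  have "\<bar>\<Sum>k<n. g k\<bar> \<le> B" for n
    unfolding mod[of n] B_def using \<open>b > 0\<close> by (intro member_le_sum) auto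
  then have B: "\<bar>\<Sum>k<n. g k * (1 / real (Suc k))\<bar> \<le> B * (1 / real (Suc 0))" for n
    by (rule Abel_inequality) (auto simp: decseq_Suc_iff field_simps)
  have "\<bar>m\<bar> * (\<Sum>k<n. 1 / real (Suc k)) \<le> M + B" for n
  proof -
    have "m * (\<Sum>k<n. 1 / real (Suc k))
        = (\<Sum>k<n. f k / real (Suc k)) - (\<Sum>k<n. g k * (1 / real (Suc k)))"
      by (simp add: g_def sum_subtractf[symmetric] sum_distrib_left diff_divide_distrib[symmetric])
    then have "\<bar>m * (\<Sum>k<n. 1 / real (Suc k))\<bar> \<le> M + B"
      using M[of n] B[of n] by simp
    moreover have "0 \<le> (\<Sum>k<n. 1 / real (Suc k))"
      by (intro sum_nonneg) auto
    ultimately show ?thesis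
      by (simp add: abs_mult)
  qed
  then have "(\<Sum>k<n. 1 / real (Suc k)) \<le> (M + B) / \<bar>m\<bar>" for n
    using \<open>m \<noteq> 0\<close> by (simp add: field_simps)
  then have "summable (\<lambda>k. 1 / real (Suc k))"
    by (intro summableI_nonneg_bounded) auto
  then have "summable (\<lambda>n. inverse (real n))"
    using summable_Suc_iff[of "\<lambda>n. inverse (real n)"] by (simp add: inverse_eq_divide)
  then show False
    using not_summable_harmonic by blast
qed

section \<open>Resonance at rationals with even denominator\<close>

definition alternating_sine :: "real \<Rightarrow> nat \<Rightarrow> real" where
  "alternating_sine \<alpha> n = (-1) ^ n * \<bar>sin (real n * pi * \<alpha>)\<bar>"

text \<open>
  The index is an integer so that products \<open>a * n\<close> with a numerator \<open>a\<close> of either sign can be reduced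
  modulo \<open>b\<close>; the sign depends on the parity of the index, which for odd \<open>a\<close> is that of \<open>n\<close>.
\<close>

definition parity_sine :: "nat \<Rightarrow> int \<Rightarrow> real" where
  "parity_sine b j = (if even j then 1 else -1) * \<bar>sin (real_of_int j * pi / real b)\<bar>"

text \<open>
  Adding a multiple of \<open>b\<close> shifts the angle by a multiple of \<open>pi\<close>, which can only change the sign of
  the sine; the parity of the index survives because \<open>b\<close> is even.
\<close>

lemma parity_sine_add_multiple:
  assumes "even b" "b > 0"
  shows "parity_sine b (j + int b * k) = parity_sine b j"
proof -
  have sin_zero: "sin (pi * real_of_int k) = 0"
    unfolding sin_zero_iff_int2 using mult.commute by blast
  have "real_of_int (j + int b * k) * pi / real b = real_of_int j * pi / real b + pi * real_of_int k"
    using \<open>b > 0\<close> by (simp add: field_simps)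
  then have "\<bar>sin (real_of_int (j + int b * k) * pi / real b)\<bar> = \<bar>sin (real_of_int j * pi / real b)\<bar>"
    using sin_zero sin_zero_abs_cos_one[OF sin_zero] by (simp only: sin_add abs_mult) simp
  then show ?thesis
    using \<open>even b\<close> by (simp add: parity_sine_def)
qed

lemma parity_sine_mod:
  assumes "even b" "b > 0"
  shows "parity_sine b (j mod int b) = parity_sine b j"
  using parity_sine_add_multiple[OF assms, of "j mod int b" "j div int b"]
  by (simp add: mod_mult_div_eq)

lemma alternating_sine_rational:
  assumes "odd a"
  shows "alternating_sine (real_of_int a / real b) n = parity_sine b (a * int n)"
  using assms by (auto simp: alternating_sine_def parity_sine_def mult_ac)

lemma alternating_sine_periodic:
  assumes "odd a" "even b" "b > 0"
  shows "alternating_sine (real_of_int a / real b) (n + b) = alternating_sine (real_of_int a / real b) n"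
  using parity_sine_add_multiple[OF assms(2,3), of "a * int n" a]
  by (simp add: alternating_sine_rational[OF \<open>odd a\<close>] algebra_simps)

text \<open>
  Multiplying by \<open>2 * cos (pi / (2 * b))\<close> makes the sum telescope. The two boundary terms have the
  same sign exactly because \<open>b\<close> is even.
\<close>

lemma sum_parity_sine_nonzero:
  assumes "even b" "b > 0"
  shows "(\<Sum>j<b. parity_sine b (int j)) \<noteq> 0"
proof -
  define \<theta> where "\<theta> = pi / real b"
  define c where "c j = (-1) ^ j * sin ((real j - 1 / 2) * \<theta>)" for j
  have "parity_sine b (int j) * (2 * cos (\<theta> / 2)) = c j - c (Suc j)" if "j < b" for j
  proof -
    have "0 \<le> sin (real j * pi / real b)"
      using that by (intro sin_ge_zero) (auto simp: field_simps)
    then have "parity_sine b (int j) = (-1) ^ j * sin (real j * \<theta>)"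
      by (simp add: parity_sine_def \<theta>_def minus_one_power_iff)
    moreover have "sin (real j * \<theta>) * (2 * cos (\<theta> / 2))
        = sin ((real j - 1 / 2) * \<theta>) + sin ((real (Suc j) - 1 / 2) * \<theta>)"
      by (simp add: sin_add sin_diff left_diff_distrib distrib_right algebra_simps add_divide_distrib)
    ultimately show ?thesis
      by (simp add: c_def algebra_simps)
  qed
  then have "(\<Sum>j<b. parity_sine b (int j)) * (2 * cos (\<theta> / 2)) = (\<Sum>j<b. c j - c (Suc j))"
    by (simp add: sum_distrib_right)
  also have "\<dots> = c 0 - c b"
    by (rule sum_lessThan_telescope')
  finally have telescoped: "(\<Sum>j<b. parity_sine b (int j)) * (2 * cos (\<theta> / 2)) = c 0 - c b" .
  have "c 0 = - sin (\<theta> / 2)"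
    by (simp add: c_def)
  moreover have "c b = sin (\<theta> / 2)"
  proof -
    have "(real b - 1 / 2) * \<theta> = pi - \<theta> / 2"
      using \<open>b > 0\<close> by (simp add: \<theta>_def field_simps)
    then show ?thesis
      using \<open>even b\<close> by (simp add: c_def)
  qed
  moreover have "0 < sin (\<theta> / 2)"
    using \<open>b > 0\<close> pi_gt_zero by (intro sin_gt_zero) (auto simp: \<theta>_def field_simps)
  ultimately have "c 0 - c b \<noteq> 0"
    by linarith
  with telescoped show ?thesis
    by (metis mult_zero_left)
qed

lemma bij_betw_mult_mod:
  fixes a m :: int
  assumes "coprime a m" "m > 0"
  shows "bij_betw (\<lambda>x. a * x mod m) {0..<m} {0..<m}"
proof -
  have "inj_on (\<lambda>x. a * x mod m) {0..<m}"
  proof (rule inj_onI)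
    fix x y assume xy: "x \<in> {0..<m}" "y \<in> {0..<m}" and "a * x mod m = a * y mod m"
    then have "m dvd a * (x - y)"
      by (simp add: mod_eq_dvd_iff right_diff_distrib)
    then have "m dvd x - y"
      using assms by (simp add: coprime_dvd_mult_right_iff coprime_commute)
    then have "x mod m = y mod m"
      by (simp add: mod_eq_dvd_iff)
    then show "x = y"
      using xy by simp
  qed
  moreover have "(\<lambda>x. a * x mod m) ` {0..<m} \<subseteq> {0..<m}"
    using \<open>m > 0\<close> by auto
  ultimately show ?thesis
    by (simp add: bij_betw_def endo_inj_surj)
qed

lemma sum_alternating_sine_nonzero:
  assumes "coprime a (int b)" "even b" "b > 0"
  shows "(\<Sum>n<b. alternating_sine (real_of_int a / real b) n) \<noteq> 0"
proof -
  have "odd a"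
    using coprime_common_divisor[OF assms(1), of 2] assms(2) by auto
  have nat_sum: "(\<Sum>j\<in>{0..<int b}. h j) = (\<Sum>j<b. h (int j))" for h :: "int \<Rightarrow> real"
    by (rule sum.reindex_bij_witness[of _ int nat]) auto
  have "(\<Sum>n<b. alternating_sine (real_of_int a / real b) n) = (\<Sum>j\<in>{0..<int b}. parity_sine b (a * j))"
    by (simp add: alternating_sine_rational[OF \<open>odd a\<close>] nat_sum)
  also have "\<dots> = (\<Sum>j\<in>{0..<int b}. parity_sine b (a * j mod int b))"
    by (simp add: parity_sine_mod assms)
  also have "\<dots> = (\<Sum>j\<in>{0..<int b}. parity_sine b j)"
    using assms by (intro sum.reindex_bij_betw bij_betw_mult_mod) auto
  also have "\<dots> \<noteq> 0"
    using sum_parity_sine_nonzero[OF assms(2,3)] by (simp add: nat_sum)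
  finally show ?thesis .
qed

section \<open>Unbounded partial sums\<close>

definition partial_sum :: "nat \<Rightarrow> real \<Rightarrow> real" where
  "partial_sum n \<alpha> = (\<Sum>k<n. alternating_sine \<alpha> (Suc k) / real (Suc k))"

lemma unbounded_partial_sum_rational:
  assumes "coprime a (int b)" "even b" "b > 0"
  shows "\<exists>n. M < \<bar>partial_sum n (real_of_int a / real b)\<bar>"
proof -
  let ?e = "alternating_sine (real_of_int a / real b)"
  have "odd a"
    using coprime_common_divisor[OF assms(1), of 2] assms(2) by auto
  note period = alternating_sine_periodic[OF this assms(2,3)]
  have "(\<Sum>k<b. ?e (Suc k)) = (\<Sum>k<b. ?e k) + ?e b - ?e 0"
    using sum.lessThan_Suc_shift[of ?e b] by simp
  also have "\<dots> = (\<Sum>k<b. ?e k)"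
    using period[of 0] by simp
  finally have "(\<Sum>k<b. ?e (Suc k)) \<noteq> 0"
    using sum_alternating_sine_nonzero[OF assms] by simp
  moreover have "?e (Suc (n + b)) = ?e (Suc n)" for n
    using period[of "Suc n"] by simp
  ultimately show ?thesis
    unfolding partial_sum_def using \<open>b > 0\<close> by (intro unbounded_harmonic_weighted_sums) auto
qed

lemma bounded_partial_sum_if_summable:
  assumes "p \<le> 1"
    and "summable (\<lambda>k. (-1) ^ Suc k * \<bar>sin (real (Suc k) * pi * \<alpha>)\<bar> / real (Suc k) powr p)"
  shows "\<exists>B. \<forall>n. \<bar>partial_sum n \<alpha>\<bar> \<le> B"
proof -
  define a where "a k = alternating_sine \<alpha> (Suc k) / real (Suc k) powr p" for k
  define g where "g k = real (Suc k) powr (p - 1)" for k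
  have "summable a"
    using assms(2) unfolding a_def alternating_sine_def .
  then have "Bseq (\<lambda>n. \<Sum>k<n. a k)"
    by (simp add: summable_iff_convergent convergent_imp_Bseq)
  then obtain B where "\<And>n. \<bar>\<Sum>k<n. a k\<bar> \<le> B"
    by (auto simp: Bseq_def)
  moreover have "decseq g"
    using \<open>p \<le> 1\<close> by (auto simp: g_def decseq_Suc_iff intro!: powr_mono2')
  ultimately have "\<bar>\<Sum>k<n. a k * g k\<bar> \<le> B * g 0" for n
    by (rule Abel_inequality) (simp add: g_def)
  moreover have "a k * g k = alternating_sine \<alpha> (Suc k) / real (Suc k)" for k
    by (simp add: a_def g_def powr_diff)
  ultimately show ?thesis
    by (auto simp: partial_sum_def)
qed

section \<open>Density and the category argument\<close>

lemma odd_over_power_of_two_dense: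
  fixes x \<epsilon> :: real
  assumes "\<epsilon> > 0"
  shows "\<exists>a K. odd a \<and> K > 0 \<and> \<bar>real_of_int a / real (2 ^ K) - x\<bar> < \<epsilon>"
proof -
  obtain k where k: "1 / 2 ^ k < \<epsilon>"
    using real_arch_pow_inv[OF assms, of "1 / 2"] by (auto simp: power_one_over)
  (* an odd number within distance 1 of 2 ^ Suc k * x *)
  define a where "a = 2 * \<lfloor>x * 2 ^ k\<rfloor> + 1"
  have "\<bar>real_of_int a - x * 2 ^ Suc k\<bar> \<le> 1"
    unfolding a_def by (simp add: abs_le_iff) linarith
  then have "\<bar>real_of_int a / 2 ^ Suc k - x\<bar> \<le> 1 / 2 ^ Suc k"
    by (simp add: abs_le_iff field_simps)
  also have "\<dots> \<le> 1 / 2 ^ k"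
    by (simp add: field_simps)
  finally have "\<bar>real_of_int a / real (2 ^ Suc k) - x\<bar> < \<epsilon>"
    using k by simp
  moreover have "odd a"
    by (simp add: a_def)
  ultimately show ?thesis
    by blast
qed

lemma dense_Inter_uncountable:
  fixes \<G> :: "real set set"
  assumes "countable \<G>" and "\<And>T. T \<in> \<G> \<Longrightarrow> open T \<and> closure T = UNIV"
  shows "closure (\<Inter>\<G>) = UNIV \<and> uncountable (\<Inter>\<G>)"
proof
  have Baire_UNIV: "closure (\<Inter>\<H>) = UNIV"
    if "countable \<H>" "\<And>T. T \<in> \<H> \<Longrightarrow> open T \<and> closure T = UNIV" for \<H> :: "real set set"
    using Baire[of UNIV \<H>] that by auto
  show "closure (\<Inter>\<G>) = UNIV"
    using assms by (rule Baire_UNIV)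
  show "uncountable (\<Inter>\<G>)"
  proof
    assume "countable (\<Inter>\<G>)"
    let ?\<H> = "\<G> \<union> (\<lambda>x. - {x}) ` \<Inter>\<G>"
    have "closure (\<Inter>?\<H>) = UNIV"
    proof (rule Baire_UNIV)
      show "countable ?\<H>"
        using \<open>countable \<G>\<close> \<open>countable (\<Inter>\<G>)\<close> by simp
      show "open T \<and> closure T = UNIV" if "T \<in> ?\<H>" for T
        using that assms(2) by (auto simp: closure_complement)
    qed
    moreover have "\<Inter>?\<H> = {}"
      by auto
    ultimately show False
      by (metis closure_empty empty_not_UNIV)
  qed
qed

theorem corollary7:
  "\<exists>L :: real set. uncountable L \<and> closure L = UNIV \<and>
     (\<forall>\<alpha>\<in>L. \<forall>p\<in>{0<..1::real}.
        \<not> summable (\<lambda>k. (-1) ^ Suc k * \<bar>sin (real (Suc k) * pi * \<alpha>)\<bar> / real (Suc k) powr p))"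
proof -
  define U where "U M = {\<alpha>. \<exists>n. real M < \<bar>partial_sum n \<alpha>\<bar>}" for M :: nat
  have "open (U M)" for M
  proof -
    have "U M = (\<Union>n. {\<alpha>. real M < \<bar>partial_sum n \<alpha>\<bar>})"
      by (auto simp: U_def)
    moreover have "open {\<alpha>. real M < \<bar>partial_sum n \<alpha>\<bar>}" for n
      unfolding partial_sum_def alternating_sine_def
      by (intro open_Collect_less continuous_intros) auto
    ultimately show ?thesis
      by auto
  qed
  moreover have "closure (U M) = UNIV" for M
  proof -
    have "\<exists>y\<in>U M. dist y x < \<epsilon>" if \<epsilon>: "\<epsilon> > 0" for x \<epsilon>
    proof -
      obtain a K where aK: "odd a" "K > 0" and "\<bar>real_of_int a / real (2 ^ K) - x\<bar> < \<epsilon>"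
        using odd_over_power_of_two_dense[OF \<epsilon>] by blast
      moreover have "real_of_int a / real (2 ^ K) \<in> U M"
        unfolding U_def mem_Collect_eq
        using aK by (intro unbounded_partial_sum_rational) simp_all
      ultimately show ?thesis
        unfolding dist_real_def by blast
    qed
    then show ?thesis
      by (auto simp: closure_approachable)
  qed
  ultimately have L: "closure (\<Inter>(range U)) = UNIV \<and> uncountable (\<Inter>(range U))"
    by (intro dense_Inter_uncountable) auto
  have "\<not> summable (\<lambda>k. (-1) ^ Suc k * \<bar>sin (real (Suc k) * pi * \<alpha>)\<bar> / real (Suc k) powr p)"
    if "\<alpha> \<in> \<Inter>(range U)" "p \<in> {0<..1}" for \<alpha> p :: real
  proof
    assume "summable (\<lambda>k. (-1) ^ Suc k * \<bar>sin (real (Suc k) * pi * \<alpha>)\<bar> / real (Suc k) powr p)"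
    then obtain B where B: "\<And>n. \<bar>partial_sum n \<alpha>\<bar> \<le> B"
      using bounded_partial_sum_if_summable[of p \<alpha>] \<open>p \<in> {0<..1}\<close> by auto
    obtain M :: nat where "B \<le> real M"
      using real_arch_simple by blast
    moreover obtain n where "real M < \<bar>partial_sum n \<alpha>\<bar>"
      using \<open>\<alpha> \<in> \<Inter>(range U)\<close> unfolding U_def by blast
    ultimately show False
      using B[of n] by linarith
  qed
  with L show ?thesis
    by blast
qed

end
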